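(* Let $G$ be a graph and $k$ a positive integer. If $G$ has a RED:LD set of cardinality at most $k$ (i.e. $\textrm{RED:LD}(G) \le k$), then $|V(G)| \le 2^{k-1}+k-2$.
   Context: $N(v)$ denotes the open neighborhood of $v$. A set $S \subseteq V(G)$ is a locating-dominating (LD) set if for all $u,v \in V(G)-S$: $N(v)\cap S \neq \varnothing$, and if $u \ne v$ then $N(v) \cap S \neq N(u) \cap S$. A RED:LD set is an LD set $S$ such that $S-\{v\}$ is an LD set for every $v \in S$. $\textrm{RED:LD}(G)$ denotes the minimum cardinality of a RED:LD set of $G$. *)

theory Defs
  imports "Graph_Theory.Pair_Digraph" "HOL-Library.Extended_Nat"
begin

text \<open>
  A simple undirected graph, finite or infinite, is a symmetric loop-free digraph whose
  arcs are pairs of vertices (\<open>pair_bidirected_digraph\<close>).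
\<close>

definition open_nbhd :: "'a pair_pre_digraph \<Rightarrow> 'a \<Rightarrow> 'a set" where
  "open_nbhd G v = {u. (v, u) \<in> parcs G}"

definition ld_set :: "'a pair_pre_digraph \<Rightarrow> 'a set \<Rightarrow> bool" where
  "ld_set G S \<longleftrightarrow> S \<subseteq> pverts G \<and>
     (\<forall>u \<in> pverts G - S. \<forall>v \<in> pverts G - S.
        open_nbhd G v \<inter> S \<noteq> {} \<and>
        (u \<noteq> v \<longrightarrow> open_nbhd G v \<inter> S \<noteq> open_nbhd G u \<inter> S))"

definition red_ld_set :: "'a pair_pre_digraph \<Rightarrow> 'a set \<Rightarrow> bool" where
  "red_ld_set G S \<longleftrightarrow> ld_set G S \<and> (\<forall>v \<in> S. ld_set G (S - {v}))"

text \<open>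
  RED:LD(G), with value \<open>\<infinity>\<close> if there is no finite RED:LD set; the lemma below shows that
  \<open>red_ld_number G \<le> k\<close> says the same as having a RED:LD set of cardinality at most \<open>k\<close>.
\<close>

definition red_ld_number :: "'a pair_pre_digraph \<Rightarrow> enat" where
  "red_ld_number G = (INF S \<in> {S. red_ld_set G S \<and> finite S}. enat (card S))"

lemma red_ld_number_le_iff:
  "red_ld_number G \<le> enat k \<longleftrightarrow> (\<exists>S. red_ld_set G S \<and> finite S \<and> card S \<le> k)"
proof
  assume le: "red_ld_number G \<le> enat k"
  let ?A = "(\<lambda>S. enat (card S)) ` {S. red_ld_set G S \<and> finite S}"
  have "?A \<noteq> {}"
  proof
    assume "?A = {}"
    then have "red_ld_number G = \<infinity>"
      unfolding red_ld_number_def by (simp add: Inf_enat_def)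
    with le show False by simp
  qed
  then have "Inf ?A \<in> ?A"
    by (metis (no_types, lifting) Inf_enat_def LeastI ex_in_conv)
  with le show "\<exists>S. red_ld_set G S \<and> finite S \<and> card S \<le> k"
    unfolding red_ld_number_def by auto
next
  assume "\<exists>S. red_ld_set G S \<and> finite S \<and> card S \<le> k"
  then obtain S where "red_ld_set G S" "finite S" "card S \<le> k" by blast
  then show "red_ld_number G \<le> enat k"
    unfolding red_ld_number_def by (intro INF_lower2[of S]) auto
qed

end

theory Submission
  imports Defs
begin

text \<open>Vertices outside \<open>T\<close> have distinct nonempty traces on \<open>T\<close>, so
  they inject into \<open>Pow T - {{}}\<close>; this also forces an a priori infinite graph to be
  finite.\<close>

lemma finite_card_verts_ld_set:
  assumes ld: "ld_set G T" and fin: "finite T"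
  shows "finite (pverts G) \<and> card (pverts G) < 2 ^ card T + card T"
proof -
  let ?f = "\<lambda>v. open_nbhd G v \<inter> T" and ?U = "pverts G - T"
  have sub: "T \<subseteq> pverts G" using ld unfolding ld_set_def by blast
  have inj: "inj_on ?f ?U" using ld unfolding ld_set_def inj_on_def by metis
  have img: "?f ` ?U \<subseteq> Pow T - {{}}" using ld unfolding ld_set_def by auto
  have finP: "finite (Pow T - {{}})" using fin by simp
  have finU: "finite ?U" by (rule inj_on_finite[OF inj img finP])
  have "card ?U \<le> card (Pow T - {{}})" by (rule card_inj_on_le[OF inj img finP])
  also have "\<dots> = 2 ^ card T - 1" using fin by (simp add: card_Pow)
  also have "\<dots> < 2 ^ card T" by simp
  finally have cardU: "card ?U < 2 ^ card T" .
  have V: "pverts G = ?U \<union> T" using sub by blast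
  have finV: "finite (pverts G)" using finU fin by (metis V finite_UnI)
  have "card (pverts G) = card ?U + card T"
    using card_Diff_subset[OF fin sub] card_mono[OF finV sub] by simp
  with finV cardU show ?thesis by simp
qed

text \<open>Deleting any one vertex from the RED:LD set leaves an LD set with at most \<open>k - 1\<close> elements,
  so the count for LD sets applies with \<open>k - 1\<close> in place of \<open>k\<close>.\<close>

theorem theorem3:
  fixes G :: "'a pair_pre_digraph" and k :: nat
  assumes "pair_bidirected_digraph G"
    and "k > 0"
    and "\<exists>S. red_ld_set G S \<and> finite S \<and> card S \<le> k"
  shows "finite (pverts G) \<and> card (pverts G) \<le> 2 ^ (k - 1) + k - 2"
proof -
  obtain S where S: "red_ld_set G S" "finite S" "card S \<le> k" using assms(3) by blast
  obtain T where T: "ld_set G T" "finite T" "card T \<le> k - 1"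
  \<comment> \<open>An empty \<open>S\<close> has no vertex to delete, but is itself an LD set of
    size \<open>0\<close>, within the bound \<open>k - 1\<close>.\<close>
  proof (cases "S = {}")
    case True
    with S show ?thesis by (intro that[of S]) (auto simp: red_ld_set_def)
  next
    case False
    then obtain v where "v \<in> S" by blast
    with S show ?thesis by (intro that[of "S - {v}"]) (auto simp: red_ld_set_def)
  qed
  \<comment> \<open>The count grows with \<open>card T\<close>, so it lies strictly below
    \<open>2 ^ (k - 1) + (k - 1)\<close>; strictness yields the final \<open>- 2\<close>, and
    \<open>k > 0\<close> keeps the subtractions from truncating.\<close>
  have "(2::nat) ^ card T \<le> 2 ^ (k - 1)" using T(3) by (simp add: power_increasing)
  with finite_card_verts_ld_set[OF T(1,2)] T(3) \<open>k > 0\<close> show ?thesis by linarith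
qed

end
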